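(* Let $n \geq 2$ be an integer, let $F = GF(2^n)$, and let $\vartheta$ be the Frobenius automorphism of $F$, that is, $\vartheta(x) = x^2$ for all $x \in F$. Let $$A(n,\vartheta) = \left\lbrace U(a,b) = \begin{bmatrix} 1 & 0 & 0\\ a & 1 & 0\\ b & \vartheta(a) & 1 \end{bmatrix} : a, b \in F \right\rbrace,$$ a group under matrix multiplication, given by $U(a,b)U(a',b') = U(a+a', b+b'+a'\vartheta(a))$. Then the Laplacian spectrum of the non-commuting graph $\mathcal{A}_{A(n,\vartheta)}$ of $A(n,\vartheta)$ is $$\{0, (2^{2n}-2^{n+1})^{(2^n-1)^2}, (2^{2n}-2^n)^{2^n-2}\}.$$
   Context: For a finite non-abelian group $G$ with centre $Z(G)$, the non-commuting graph $\mathcal{A}_G$ is the simple undirected graph with vertex set $G \setminus Z(G)$ in which two vertices $x,y$ are adjacent if and only if $xy \neq yx$. The Laplacian matrix of a finite graph is $D - A$, with $D$ the degree matrix and $A$ the adjacency matrix. The Laplacian spectrum is the multiset of eigenvalues of the Laplacian matrix; $\{\dots,\alpha^{a},\dots\}$ means the eigenvalue $\alpha$ is listed with multiplicity $a$ (not a power; no exponent means once, exponent $0$ means the entry is absent, and if listed values coincide their multiplicities add). *)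

theory Defs
  imports
    "HOL-Library.Cardinality"
    "HOL-Number_Theory.Residues"
    "Jordan_Normal_Form.Char_Poly"
    "Graph_Theory.Graph_Theory"
begin

definition group_center :: "('a, 'b) monoid_scheme \<Rightarrow> 'a set" where
  "group_center G =
    {z \<in> carrier G. \<forall>x \<in> carrier G. z \<otimes>\<^bsub>G\<^esub> x = x \<otimes>\<^bsub>G\<^esub> z}"

text \<open>As usual for \<^typ>\<open>'a pair_pre_digraph\<close>, an undirected edge is represented by
  the two opposite arcs.\<close>

definition non_commuting_graph :: "('a, 'b) monoid_scheme \<Rightarrow> 'a pair_pre_digraph" where
  "non_commuting_graph G =
    \<lparr> pverts = carrier G - group_center G,
      parcs = {(x, y). x \<in> carrier G - group_center G \<and> y \<in> carrier G - group_center G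
                 \<and> x \<otimes>\<^bsub>G\<^esub> y \<noteq> y \<otimes>\<^bsub>G\<^esub> x} \<rparr>"

lemma pair_graph_non_commuting_graph:
  assumes "finite (carrier G)"
  shows "pair_graph (non_commuting_graph G)"
proof
  show "finite (pverts (non_commuting_graph G))"
    using assms by (simp add: non_commuting_graph_def)
  have "parcs (non_commuting_graph G) \<subseteq> carrier G \<times> carrier G"
    by (auto simp: non_commuting_graph_def)
  then show "finite (parcs (non_commuting_graph G))"
    using assms finite_subset by blast
  show "symmetric (non_commuting_graph G)"
    unfolding symmetric_def
    by (auto simp: non_commuting_graph_def arcs_ends_def arc_to_ends_def sym_def)
qed (auto simp: non_commuting_graph_def)

text \<open>The matrices below depend on an enumeration \<open>vs\<close> of the vertices, which labels the rows
  and columns. In a symmetric digraph the out-degree is the degree of the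
  underlying undirected graph.\<close>

definition adjacency_mat :: "('a, 'b) pre_digraph \<Rightarrow> 'a list \<Rightarrow> real mat" where
  "adjacency_mat G vs = mat (length vs) (length vs)
    (\<lambda>(i, j). if vs ! i \<rightarrow>\<^bsub>G\<^esub> vs ! j then 1 else 0)"

definition degree_mat :: "('a, 'b) pre_digraph \<Rightarrow> 'a list \<Rightarrow> real mat" where
  "degree_mat G vs = mat (length vs) (length vs)
    (\<lambda>(i, j). if i = j then real (out_degree G (vs ! i)) else 0)"

definition laplacian_mat :: "('a, 'b) pre_digraph \<Rightarrow> 'a list \<Rightarrow> real mat" where
  "laplacian_mat G vs = degree_mat G vs - adjacency_mat G vs"

text \<open>The eigenvalues with their algebraic multiplicities. Laplacian matrices of undirected graphs
  are real symmetric, so no eigenvalue is lost by working over the reals, and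
  algebraic and geometric multiplicities coincide.\<close>

definition eigenvalue_mset :: "real mat \<Rightarrow> real multiset" where
  "eigenvalue_mset M = proots (char_poly M)"

lemma set_mset_eigenvalue_mset:
  assumes "M \<in> carrier_mat k k"
  shows "set_mset (eigenvalue_mset M) = {x. eigenvalue M x}"
proof -
  have "char_poly M \<noteq> 0"
    using degree_monic_char_poly[OF assms] by auto
  then show ?thesis
    by (simp add: eigenvalue_mset_def eigenvalue_root_char_poly[OF assms])
qed

definition U_mat :: "('f \<Rightarrow> 'f) \<Rightarrow> 'f \<Rightarrow> 'f \<Rightarrow> 'f :: field mat" where
  "U_mat \<theta> a b = mat_of_rows_list 3
    [[1, 0,   0],
     [a, 1,   0],
     [b, \<theta> a, 1]]"

text \<open>For the group $A(n,\vartheta)$, the type \<open>'f\<close> is the field with $2^n$ elements.\<close>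

definition A_group :: "('f :: field \<Rightarrow> 'f) \<Rightarrow> 'f mat monoid" where
  "A_group \<theta> = \<lparr> carrier = {U_mat \<theta> a b | a b. True}, monoid.mult = (*), one = 1\<^sub>m 3 \<rparr>"

lemma U_mat_mult:
  assumes "\<And>x y. \<theta> (x + y) = \<theta> x + \<theta> y"
  shows "U_mat \<theta> a b * U_mat \<theta> a' b' = U_mat \<theta> (a + a') (b + b' + a' * \<theta> a)"
proof (rule eq_matI)
  have sum3: "sum f {0..<3} = f 0 + f 1 + f 2" for f :: "nat \<Rightarrow> 'a"
    by (simp add: numeral_3_eq_3 numeral_2_eq_2)
  fix i j
  assume "i < dim_row (U_mat \<theta> (a + a') (b + b' + a' * \<theta> a))"
    and "j < dim_col (U_mat \<theta> (a + a') (b + b' + a' * \<theta> a))"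
  then have "i < 3" "j < 3"
    by (simp_all add: U_mat_def mat_of_rows_list_def)
  then have "i = 0 \<or> i = 1 \<or> i = 2" "j = 0 \<or> j = 1 \<or> j = 2"
    by linarith+
  then show "(U_mat \<theta> a b * U_mat \<theta> a' b') $$ (i, j) =
      U_mat \<theta> (a + a') (b + b' + a' * \<theta> a) $$ (i, j)"
    by (elim disjE)
      (simp_all add: U_mat_def mat_of_rows_list_def scalar_prod_def sum3 assms)
qed (simp_all add: U_mat_def mat_of_rows_list_def)

lemma U_mat_inject: "U_mat \<theta> a b = U_mat \<theta> a' b' \<longleftrightarrow> a = a' \<and> b = b'"
proof
  assume eq: "U_mat \<theta> a b = U_mat \<theta> a' b'"
  have "U_mat \<theta> c d $$ (1, 0) = c \<and> U_mat \<theta> c d $$ (2, 0) = d" for c d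
    by (simp add: U_mat_def mat_of_rows_list_def)
  from this[of a b] this[of a' b'] show "a = a' \<and> b = b'"
    unfolding eq by argo
qed simp

lemma CHAR_eq_2:
  assumes "card (UNIV :: 'f :: field set) = 2 ^ n"
  shows "CHAR('f) = 2"
proof -
  have "finite (UNIV :: 'f set)"
    using assms by (intro card_ge_0_finite) simp
  then have prime: "prime CHAR('f)"
    by (intro prime_CHAR_semidom finite_imp_CHAR_pos)
  have "CHAR('f) dvd 2 ^ n"
    using CHAR_dvd_CARD[where 'a = 'f] assms by simp
  then have "CHAR('f) dvd 2"
    by (rule prime_dvd_power[OF prime])
  then show ?thesis
    by (rule primes_dvd_imp_eq[OF prime two_is_prime_nat])
qed

lemma frobenius_add:
  fixes x y :: "'f :: field"
  assumes "CARD('f) = 2 ^ n"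
  shows "(x + y)\<^sup>2 = x\<^sup>2 + y\<^sup>2"
  by (rule freshmans_dream) (simp_all add: CHAR_eq_2[OF assms])

lemma group_A_group:
  fixes \<theta> :: "'f :: field \<Rightarrow> 'f"
  assumes add: "\<And>x y. \<theta> (x + y) = \<theta> x + \<theta> y"
  shows "group (A_group \<theta>)"
proof -
  note mult = U_mat_mult[of \<theta>, OF add]
  have zero: "\<theta> 0 = 0"
    using add[of 0 0] by (metis add_0 add_cancel_right_right)
  have one_eq: "1\<^sub>m 3 = U_mat \<theta> 0 0"
    by (rule eq_matI)
      (auto simp: U_mat_def mat_of_rows_list_def zero numeral_3_eq_3 less_Suc_eq)
  show ?thesis
  proof (rule groupI)
    fix x assume "x \<in> carrier (A_group \<theta>)"
    then obtain a b where x: "x = U_mat \<theta> a b"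
      by (auto simp: A_group_def)
    have neg: "\<theta> (- a) = - \<theta> a"
      using add[of "- a" a] zero by (simp add: eq_neg_iff_add_eq_0)
    have "U_mat \<theta> (- a) (a * \<theta> a - b) * x = 1\<^sub>m 3"
      by (simp add: x mult one_eq neg)
    then show "\<exists>y\<in>carrier (A_group \<theta>). y \<otimes>\<^bsub>A_group \<theta>\<^esub> x = \<one>\<^bsub>A_group \<theta>\<^esub>"
      by (auto simp: A_group_def)
  qed (auto simp: A_group_def one_eq mult zero U_mat_inject add algebra_simps)
qed

lemma A_group_not_commutative:
  fixes \<theta> :: "'f :: field \<Rightarrow> 'f"
  assumes "n \<ge> 2" "CARD('f) = 2 ^ n" and \<theta>: "\<And>x. \<theta> x = x\<^sup>2"
  shows "\<not> comm_group (A_group \<theta>)"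
proof
  assume "comm_group (A_group \<theta>)"
  then interpret comm_group "A_group \<theta>" .
  have add: "\<theta> (x + y) = \<theta> x + \<theta> y" for x y
    using frobenius_add[OF assms(2)] by (simp add: \<theta>)
  have "(2 :: nat) ^ 2 \<le> 2 ^ n"
    using assms(1) by (rule power_increasing) simp
  then have "CARD('f) \<noteq> card {0, 1 :: 'f}"
    using assms(2) by simp
  then have "UNIV \<noteq> {0, 1 :: 'f}"
    by metis
  then obtain c :: 'f where c: "c \<noteq> 0" "c \<noteq> 1"
    by blast
  have "U_mat \<theta> 1 0 * U_mat \<theta> c 0 = U_mat \<theta> c 0 * U_mat \<theta> 1 0"
    using m_comm[of "U_mat \<theta> 1 0" "U_mat \<theta> c 0"] by (auto simp: A_group_def)
  then have "c = c\<^sup>2"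
    by (simp add: U_mat_mult[of \<theta>, OF add] U_mat_inject \<theta>)
  with c show False
    by (simp add: power2_eq_square)
qed

end

(* The elements U(a,b) and U(a',b') commute iff a = 0, a' = 0 or a = a', so the non-commuting
   graph is complete multipartite: its q - 1 parts (q = 2^n) are the sets {U(a,b) | b} with a
   nonzero, each of size q. Its Laplacian is c I - A B, where c = q(q - 2) and A, B have inner
   dimension q - 1. The identity y^m det(y I + A B) = y^N det(y I + B A) (for A of size N x m) reduces the
   characteristic polynomial to the determinant of a multiple of the all-ones matrix of size
   q - 1 plus a scalar matrix, and the same identity, now with inner dimension 1, evaluates it. *)

theory Submission
  imports Defs
begin

section \<open>Determinant identities and the Laplacian of a complete multipartite graph\<close>

text \<open>Both sides equal \<open>y ^ m * det M\<close> for the block matrix \<open>M\<close> with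
  rows (y I, -A) and (B, I). Multiplying \<open>M\<close> on the left by a unitriangular block
  matrix clears the block -A; multiplying by a block lower triangular matrix of determinant
  \<open>y ^ m\<close> clears the block B. No division by \<open>y\<close> occurs.\<close>

lemma det_add_mult_commute:
  fixes A B :: "'a :: idom mat"
  assumes A: "A \<in> carrier_mat N m" and B: "B \<in> carrier_mat m N"
  shows "y ^ m * det (y \<cdot>\<^sub>m 1\<^sub>m N + A * B) = y ^ N * det (y \<cdot>\<^sub>m 1\<^sub>m m + B * A)"
proof -
  define M where "M = four_block_mat (y \<cdot>\<^sub>m 1\<^sub>m N) (- A) B (1\<^sub>m m)"
  have M: "M \<in> carrier_mat (N + m) (N + m)"
    by (simp add: M_def)
  have "four_block_mat (1\<^sub>m N) A (0\<^sub>m m N) (1\<^sub>m m) * M =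
      four_block_mat (y \<cdot>\<^sub>m 1\<^sub>m N + A * B) (0\<^sub>m N m) B (1\<^sub>m m)"
    unfolding M_def using A B
    by (subst mult_four_block_mat[of _ N N _ m _ m _ _ N _ m])
      (auto intro!: cong_four_block_mat)
  from arg_cong[OF this, of det] have 1: "det M = det (y \<cdot>\<^sub>m 1\<^sub>m N + A * B)"
    using A B M
    by (simp add: det_mult[of _ "N + m"] det_four_block_mat_lower_left_zero[of _ N _ m]
        det_four_block_mat_upper_right_zero[of _ N _ m])
  have "- B * (y \<cdot>\<^sub>m 1\<^sub>m N) + y \<cdot>\<^sub>m 1\<^sub>m m * B = 0\<^sub>m m N"
  proof -
    have "- B * (y \<cdot>\<^sub>m 1\<^sub>m N) = y \<cdot>\<^sub>m (- B)"
      using B mult_smult_distrib[of "- B" m N "1\<^sub>m N" N y] by simp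
    moreover have "y \<cdot>\<^sub>m 1\<^sub>m m * B = y \<cdot>\<^sub>m B"
      using B mult_smult_assoc_mat[of "1\<^sub>m m" m m B N y] by simp
    ultimately show ?thesis
      using B by (intro eq_matI) auto
  qed
  moreover have "- B * - A + y \<cdot>\<^sub>m 1\<^sub>m m * 1\<^sub>m m = y \<cdot>\<^sub>m 1\<^sub>m m + B * A"
  proof -
    have "- B * - A = B * A"
      using A B by (intro eq_matI) auto
    then show ?thesis
      using A B by (simp add: comm_add_mat[of _ m m])
  qed
  ultimately have "four_block_mat (1\<^sub>m N) (0\<^sub>m N m) (- B) (y \<cdot>\<^sub>m 1\<^sub>m m) * M =
      four_block_mat (y \<cdot>\<^sub>m 1\<^sub>m N) (- A) (0\<^sub>m m N) (y \<cdot>\<^sub>m 1\<^sub>m m + B * A)"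
    unfolding M_def using A B
    by (subst mult_four_block_mat[of _ N N _ m _ m _ _ N _ m]) simp_all
  from arg_cong[OF this, of det] have "y ^ m * det M = y ^ N * det (y \<cdot>\<^sub>m 1\<^sub>m m + B * A)"
    using A B M
    by (simp add: det_mult[of _ "N + m"] det_four_block_mat_lower_left_zero[of _ N _ m]
        det_four_block_mat_upper_right_zero[of _ N _ m])
  with 1 show ?thesis
    by simp
qed

text \<open>The constant matrix is a column times a row, so \<open>det_add_mult_commute\<close> with
  inner dimension 1 leaves a 1 x 1 determinant. The factor \<open>y\<close> on the left stays
  because \<open>y\<close> may be zero.\<close>

lemma det_scalar_add_const:
  fixes y s :: "'a :: idom"
  shows "y * det (mat k k (\<lambda>(i, j). (if i = j then y else 0) + s)) = y ^ k * (y + of_nat k * s)"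
proof -
  define A :: "'a mat" where "A = mat k 1 (\<lambda>_. s)"
  define B :: "'a mat" where "B = mat 1 k (\<lambda>_. 1)"
  have AB: "A \<in> carrier_mat k 1" "B \<in> carrier_mat 1 k"
    by (simp_all add: A_def B_def)
  have "y \<cdot>\<^sub>m 1\<^sub>m k + A * B = mat k k (\<lambda>(i, j). (if i = j then y else 0) + s)"
    by (rule eq_matI) (auto simp: A_def B_def scalar_prod_def)
  moreover have "det (y \<cdot>\<^sub>m 1\<^sub>m 1 + B * A) = y + of_nat k * s"
    by (subst det_single) (auto simp: A_def B_def scalar_prod_def)
  ultimately show ?thesis
    using det_add_mult_commute[OF AB, of y] by simp
qed

text \<open>For \<open>c = q * (m - 1)\<close> this is the Laplacian of the complete multipartite graph with
  \<open>m\<close> parts of size \<open>q\<close>, where \<open>g i\<close> is the part of the \<open>i\<close>-th vertex.\<close>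

lemma proots_char_poly_multipartite:
  fixes g :: "nat \<Rightarrow> nat" and c :: real
  assumes g: "\<And>i. i < N \<Longrightarrow> g i < m"
    and fiber: "\<And>k. k < m \<Longrightarrow> card {i. i < N \<and> g i = k} = q"
    and q: "q > 0" and m: "m > 0" and N: "N = q * m"
  defines "L \<equiv> mat N N (\<lambda>(i, j). (if i = j then c else 0) - (if g i = g j then 0 else 1))"
  shows "proots (char_poly L) = {#c - real q * (real m - 1)#}
    + replicate_mset (N - m) c + replicate_mset (m - 1) (c + real q)"
proof -
  \<comment> \<open>\<open>B\<close> records membership of a vertex in a part and \<open>A\<close>
    records non-membership, so that \<open>A * B\<close> is the adjacency matrix.\<close>
  define A :: "real mat" where "A = mat N m (\<lambda>(i, k). if g i = k then 0 else 1)"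
  define B :: "real mat" where "B = mat m N (\<lambda>(k, j). if g j = k then 1 else 0)"
  have AB: "A \<in> carrier_mat N m" "B \<in> carrier_mat m N"
    by (simp_all add: A_def B_def)
  have L: "L \<in> carrier_mat N N"
    by (simp add: L_def)
  \<comment> \<open>The linear factors of the three expected eigenvalues.\<close>
  define C where "C = [:- c, 1:]"
  define D where "D = [:- (c + real q), 1:]"
  define E where "E = [:- (c - real q * (real m - 1)), 1:]"
  have AB_eq: "- char_matrix L x = (x - c) \<cdot>\<^sub>m 1\<^sub>m N + A * B" for x
  proof (rule eq_matI)
    fix i j
    assume "i < dim_row ((x - c) \<cdot>\<^sub>m 1\<^sub>m N + A * B)" "j < dim_col ((x - c) \<cdot>\<^sub>m 1\<^sub>m N + A * B)"
    then have ij: "i < N" "j < N"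
      by (simp_all add: A_def B_def)
    have "(A * B) $$ (i, j) = (\<Sum>k<m. (if g i = k then 0 else 1) * (if g j = k then 1 else 0))"
      using ij by (simp add: A_def B_def scalar_prod_def atLeast0LessThan)
    also have "\<dots> = (\<Sum>k<m. if g j = k then if g i = g j then 0 else 1 else 0)"
      by (rule sum.cong) auto
    also have "\<dots> = (if g i = g j then 0 else 1)"
      using g[OF ij(2)] by simp
    finally show "(- char_matrix L x) $$ (i, j) = ((x - c) \<cdot>\<^sub>m 1\<^sub>m N + A * B) $$ (i, j)"
      using ij AB by (simp add: L_def char_matrix_def)
  qed (use AB in \<open>simp_all add: L_def char_matrix_def\<close>)
  \<comment> \<open>Entry (k, l) of \<open>B * A\<close> counts the vertices that are in part k but
    not in part l: 0 on the diagonal and q elsewhere.\<close>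
  have BA_eq: "(x - c) \<cdot>\<^sub>m 1\<^sub>m m + B * A =
      mat m m (\<lambda>(i, j). (if i = j then x - c - real q else 0) + real q)" for x
  proof (rule eq_matI)
    fix k l
    assume "k < dim_row (mat m m (\<lambda>(i, j). (if i = j then x - c - real q else 0) + real q))"
      "l < dim_col (mat m m (\<lambda>(i, j). (if i = j then x - c - real q else 0) + real q))"
    then have kl: "k < m" "l < m"
      by simp_all
    have "(B * A) $$ (k, l) = (\<Sum>i<N. (if g i = k then 1 else 0) * (if g i = l then 0 else 1))"
      using kl by (simp add: A_def B_def scalar_prod_def atLeast0LessThan)
    also have "\<dots> = (\<Sum>i<N. if g i = k then if k = l then 0 else 1 else 0)"
      by (rule sum.cong) auto
    also have "\<dots> = (\<Sum>i\<in>{i. i < N \<and> g i = k}. if k = l then 0 else 1)"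
      by (rule sum.mono_neutral_cong_right) auto
    also have "\<dots> = (if k = l then 0 else real q)"
      using fiber[OF kl(1)] by simp
    finally show "((x - c) \<cdot>\<^sub>m 1\<^sub>m m + B * A) $$ (k, l) =
        mat m m (\<lambda>(i, j). (if i = j then x - c - real q else 0) + real q) $$ (k, l)"
      using kl AB by simp
  qed (use AB in simp_all)
  \<comment> \<open>The surplus factors \<open>C ^ m\<close> and \<open>D\<close> come from the two
    determinant identities. At a single point x they may vanish, so they are cancelled only later,
    as nonzero polynomials.\<close>
  have "poly (C ^ m * D * char_poly L) x = poly (C ^ N * D ^ m * E) x" for x
  proof -
    have "(x - c) ^ m * poly (char_poly L) x = (x - c) ^ N *
        det (mat m m (\<lambda>(i, j). (if i = j then x - c - real q else 0) + real q))"
      unfolding char_poly_matrix[OF L] AB_eq det_add_mult_commute[OF AB] BA_eq ..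
    then have "(x - c - real q) * ((x - c) ^ m * poly (char_poly L) x) =
        (x - c) ^ N * ((x - c - real q) *
          det (mat m m (\<lambda>(i, j). (if i = j then x - c - real q else 0) + real q)))"
      by simp
    then show ?thesis
      unfolding det_scalar_add_const by (simp add: C_def D_def E_def algebra_simps)
  qed
  then have "C ^ m * D * char_poly L = C ^ N * D ^ m * E"
    by (simp add: poly_eq_poly_eq_iff[symmetric] fun_eq_iff)
  also have "\<dots> = C ^ m * D * (C ^ (N - m) * D ^ (m - 1) * E)"
  proof -
    \<comment> \<open>Since q > 0, m is at most N and the natural subtraction is exact.\<close>
    have "N = m + (N - m)" "m = Suc (m - 1)"
      using q m N by simp_all
    then have "C ^ N = C ^ m * C ^ (N - m)" "D ^ m = D * D ^ (m - 1)"
      by (metis power_add) (metis \<open>m = Suc (m - 1)\<close> power_Suc)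
    then show ?thesis
      by (simp add: ac_simps)
  qed
  finally have "C ^ m * D * char_poly L = C ^ m * D * (C ^ (N - m) * D ^ (m - 1) * E)" .
  moreover have nonzero: "C \<noteq> 0" "D \<noteq> 0" "E \<noteq> 0"
    by (simp_all add: C_def D_def E_def)
  ultimately have "char_poly L = C ^ (N - m) * D ^ (m - 1) * E"
    by simp
  moreover have "proots C = {#c#}" "proots D = {#c + real q#}"
      "proots E = {#c - real q * (real m - 1)#}"
    unfolding C_def D_def E_def proots_linear_factor by simp_all
  ultimately show ?thesis
    using nonzero by (simp add: proots_mult proots_power)
qed

section \<open>Commuting elements and the centre of the group\<close>

lemma A_group_mult:
  fixes \<theta> :: "'f :: field \<Rightarrow> 'f"
  assumes "CARD('f) = 2 ^ n" and \<theta>: "\<And>x. \<theta> x = x\<^sup>2"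
  shows "U_mat \<theta> a b \<otimes>\<^bsub>A_group \<theta>\<^esub> U_mat \<theta> a' b' = U_mat \<theta> (a + a') (b + b' + a' * a\<^sup>2)"
  using U_mat_mult[of \<theta> a b a' b'] frobenius_add[OF assms(1)] by (simp add: A_group_def \<theta>)

text \<open>The two products can differ only in the second parameter, and the difference of the
  twisting terms factors as a a' (a - a') up to sign.\<close>

lemma A_group_commute_iff:
  fixes \<theta> :: "'f :: field \<Rightarrow> 'f"
  assumes "CARD('f) = 2 ^ n" "\<And>x. \<theta> x = x\<^sup>2"
  shows "U_mat \<theta> a b \<otimes>\<^bsub>A_group \<theta>\<^esub> U_mat \<theta> a' b' = U_mat \<theta> a' b' \<otimes>\<^bsub>A_group \<theta>\<^esub> U_mat \<theta> a b
    \<longleftrightarrow> a = 0 \<or> a' = 0 \<or> a = a'"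
proof -
  have "a' * a\<^sup>2 = a * a'\<^sup>2 \<longleftrightarrow> a * a' * (a - a') = 0"
    by (simp add: power2_eq_square algebra_simps)
  then show ?thesis
    unfolding A_group_mult[OF assms] U_mat_inject by (simp add: add.commute)
qed

text \<open>The field has at least 4 elements, so for nonzero a some c lies outside {0, a}; elements
  with first parameter c then do not commute with U(a,b).\<close>

lemma A_group_noncentral:
  fixes \<theta> :: "'f :: field \<Rightarrow> 'f"
  assumes "n \<ge> 2" and card: "CARD('f) = 2 ^ n" and \<theta>: "\<And>x. \<theta> x = x\<^sup>2"
  shows "carrier (A_group \<theta>) - group_center (A_group \<theta>) = (\<lambda>(a, b). U_mat \<theta> a b) ` ((- {0}) \<times> UNIV)"
proof -
  have carrier: "carrier (A_group \<theta>) = range (\<lambda>(a, b). U_mat \<theta> a b)"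
    by (auto simp: A_group_def)
  have "U_mat \<theta> a b \<in> group_center (A_group \<theta>) \<longleftrightarrow> a = 0" for a b
  proof -
    have "(2 :: nat) ^ 2 \<le> 2 ^ n"
      using assms(1) by (rule power_increasing) simp
    moreover have "card {0, a} \<le> 2"
      by (simp add: card_insert_if)
    ultimately have "UNIV \<noteq> {0, a}"
      using card by auto
    then obtain c where "c \<noteq> 0" "c \<noteq> a"
      by blast
    then show ?thesis
      unfolding group_center_def carrier
      by (auto simp: A_group_commute_iff[OF card \<theta>])
  qed
  then show ?thesis
    unfolding carrier by auto
qed

section \<open>Parts, degrees and spectrum of the non-commuting graph\<close>

theorem proposition4p5:
  fixes n :: nat
    and \<theta> :: "'f :: field \<Rightarrow> 'f"
    and vs :: "'f mat list"
  assumes "n \<ge> 2"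
    and "CARD('f) = 2 ^ n"
    and "\<And>x. \<theta> x = x\<^sup>2"
    and "distinct vs"
    and "set vs = verts (non_commuting_graph (A_group \<theta>))"
  shows "eigenvalue_mset (laplacian_mat (non_commuting_graph (A_group \<theta>)) vs) =
    {#0#}
    + replicate_mset ((2 ^ n - 1)\<^sup>2) (2 ^ (2 * n) - 2 ^ (n + 1))
    + replicate_mset (2 ^ n - 2) (2 ^ (2 * n) - 2 ^ n)"
proof -
  let ?G = "non_commuting_graph (A_group \<theta>)"
  define q :: nat where "q = 2 ^ n"
  \<comment> \<open>The entry a of U(a,b), which determines the part of a vertex.\<close>
  define p :: "'f mat \<Rightarrow> 'f" where "p v = v $$ (1, 0)" for v
  have p [simp]: "p (U_mat \<theta> a b) = a" for a b
    by (simp add: p_def U_mat_def mat_of_rows_list_def)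
  have "(2 :: nat) ^ 2 \<le> 2 ^ n"
    using assms(1) by (rule power_increasing) simp
  then have q: "q \<ge> 4"
    by (simp add: q_def)
  have card: "CARD('f) = q"
    using assms(2) by (simp add: q_def)
  have fin: "finite (UNIV :: 'f set)"
    using card q by (intro card_ge_0_finite) simp
  have set_vs: "set vs = (\<lambda>(a, b). U_mat \<theta> a b) ` ((- {0}) \<times> UNIV)"
    using assms(5) A_group_noncentral[OF assms(1-3)] by (simp add: non_commuting_graph_def)
  have inj: "inj_on (\<lambda>(a, b). U_mat \<theta> a b) S" for S
    by (auto simp: inj_on_def U_mat_inject)
  have units: "card (- {0 :: 'f}) = q - 1"
    using fin card by (simp add: card_Diff_singleton Compl_eq_Diff_UNIV)
  have card_vs: "card (set vs) = q * (q - 1)"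
    unfolding set_vs by (simp add: card_image[OF inj] card_cartesian_product units card)
  then have len: "length vs = q * (q - 1)"
    using assms(4) by (simp add: distinct_card)
  have part: "{v \<in> set vs. p v = a} = (\<lambda>(a, b). U_mat \<theta> a b) ` ({a} \<times> UNIV)" if "a \<noteq> 0" for a
    using that unfolding set_vs by auto
  have card_part: "card {v \<in> set vs. p v = a} = q" if "a \<noteq> 0" for a
    unfolding part[OF that] by (simp add: card_image[OF inj] card_cartesian_product card)
  have arc: "u \<rightarrow>\<^bsub>?G\<^esub> v \<longleftrightarrow> p u \<noteq> p v" if "u \<in> set vs" "v \<in> set vs" for u v
    using that A_group_noncentral[OF assms(1-3)] unfolding set_vs
    by (auto simp: non_commuting_graph_def A_group_commute_iff[OF assms(2,3)])
  have p_nz: "p v \<noteq> 0" if "v \<in> set vs" for v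
    using that unfolding set_vs by auto
  have degree: "out_degree ?G u = q * (q - 1) - q" if u: "u \<in> set vs" for u
  proof -
    have "out_arcs ?G u = Pair u ` {v \<in> set vs. u \<rightarrow>\<^bsub>?G\<^esub> v}"
      using assms(5) by (auto simp: out_arcs_def non_commuting_graph_def)
    also have "{v \<in> set vs. u \<rightarrow>\<^bsub>?G\<^esub> v} = set vs - {v \<in> set vs. p v = p u}"
      using arc[OF u] by auto
    finally have "out_degree ?G u = card (set vs - {v \<in> set vs. p v = p u})"
      by (simp add: out_degree_def card_image inj_on_def)
    also have "\<dots> = q * (q - 1) - q"
      by (subst card_Diff_subset) (simp_all add: card_vs card_part[OF p_nz[OF u]] subset_iff)
    finally show ?thesis .
  qed
  \<comment> \<open>Numbering the nonzero field elements turns the parts into indices below q - 1,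
    as \<open>proots_char_poly_multipartite\<close> expects.\<close>
  obtain h where h: "bij_betw h (- {0 :: 'f}) {0..<q - 1}"
    using ex_bij_betw_finite_nat[of "- {0 :: 'f}"] fin units by (metis finite_subset subset_UNIV)
  define g where "g i = h (p (vs ! i))" for i
  have nz: "p (vs ! i) \<in> - {0}" if "i < length vs" for i
    using p_nz that by simp
  have g_eq: "g i = g j \<longleftrightarrow> p (vs ! i) = p (vs ! j)" if "i < length vs" "j < length vs" for i j
    unfolding g_def using bij_betw_imp_inj_on[OF h] nz that by (metis inj_on_eq_iff)
  have g: "g i < q - 1" if "i < length vs" for i
    using bij_betwE[OF h] nz[OF that] by (simp add: g_def)
  have fiber: "card {i. i < length vs \<and> g i = k} = q" if k: "k < q - 1" for k
  proof -
    have "k \<in> h ` (- {0})"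
      using bij_betw_imp_surj_on[OF h] k by simp
    then obtain a where a: "a \<noteq> 0" "h a = k"
      by (elim imageE) simp
    have "g i = k \<longleftrightarrow> p (vs ! i) = a" if "i < length vs" for i
      unfolding g_def using bij_betw_imp_inj_on[OF h] nz[OF that] a
      by (metis ComplI inj_on_eq_iff singletonD)
    then have "(!) vs ` {i. i < length vs \<and> g i = k} = {v \<in> set vs. p v = a}"
      by (auto simp: in_set_conv_nth image_iff)
    moreover have "inj_on ((!) vs) {i. i < length vs \<and> g i = k}"
      using assms(4) by (auto simp: inj_on_def nth_eq_iff_index_eq)
    ultimately show ?thesis
      using card_part[OF a(1)] by (simp flip: card_image)
  qed
  \<comment> \<open>The common degree q(q - 2) as a real number. It equals q(m - 1) for m = q - 1
    parts, which makes the simple eigenvalue 0.\<close>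
  define c where "c = real q * (real q - 1) - real q"
  have "real (q * (q - 1) - q) = c"
  proof -
    have "q * 1 \<le> q * (q - 1)"
      using q by (intro mult_le_mono2) simp
    then show ?thesis
      using q by (simp add: c_def of_nat_diff)
  qed
  then have L: "laplacian_mat ?G vs = mat (length vs) (length vs)
      (\<lambda>(i, j). (if i = j then c else 0) - (if g i = g j then 0 else 1))"
    by (intro eq_matI)
      (simp_all add: laplacian_mat_def degree_mat_def adjacency_mat_def arc degree g_eq
        del: with_proj_simps)
  \<comment> \<open>The multiplicity of \<open>c\<close>: q(q - 1) - (q - 1) is the square of q -
    1.\<close>
  have N: "length vs - (q - 1) = (q - 1)\<^sup>2"
    unfolding len by (cases q) (simp_all add: power2_eq_square)
  have pow: "(2 :: real) ^ (2 * n) = (real q)\<^sup>2" "(2 :: real) ^ n = real q"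
    by (simp_all add: q_def power_mult mult.commute[of 2])
  have "eigenvalue_mset (laplacian_mat ?G vs) = {#c - real q * (real (q - 1) - 1)#}
      + replicate_mset (length vs - (q - 1)) c + replicate_mset (q - 1 - 1) (c + real q)"
    unfolding eigenvalue_mset_def L
    by (rule proots_char_poly_multipartite[OF g fiber]) (use q len in simp_all)
  also have "c - real q * (real (q - 1) - 1) = 0"
    using q by (simp add: c_def of_nat_diff algebra_simps)
  also have "c + real q = 2 ^ (2 * n) - 2 ^ n"
    unfolding c_def pow by (simp add: power2_eq_square algebra_simps)
  also have "c = 2 ^ (2 * n) - 2 ^ (n + 1)"
    unfolding c_def power_add power_one_right pow
    by (simp add: power2_eq_square algebra_simps)
  also have "length vs - (q - 1) = (2 ^ n - 1)\<^sup>2"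
    using N by (simp only: q_def)
  also have "q - 1 - 1 = 2 ^ n - 2"
    by (simp add: q_def)
  finally show ?thesis .
qed

end
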